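(* Let $r=N/D$ be a strictly proper rational function over $\mathbb{C}$, where $N,D$ are coprime polynomials, $D$ is monic of degree $\lambda$, $D(0)\neq 0$, all poles of $r$ lie in a disk $|z|<R$, and all roots $z_1,\dots,z_\lambda$ of $D$ are simple. Let $\nu$ be an integer with $1<\nu<\lambda$, and assume the roots are numbered so that $$\rho:=|z_1|=\cdots=|z_\nu|>|z_{\nu+1}|>|z_{\nu+2}|\ge\cdots\ge|z_\lambda|$$ (for $\nu=\lambda-1$ this reads $|z_1|=\cdots=|z_\nu|>|z_\lambda|$). Assume further that $z_1,\dots,z_\nu$ are among the vertices of a regular $\sigma$-gon centered at the origin, for some integer $\sigma\ge\nu$; that is, $z_1^\sigma=\cdots=z_\nu^\sigma$. Let $\pi^r_{n,\lambda-1}$ be the Padé approximant of type $(n,\lambda-1)$ of $r$ at the origin, and let the polynomials $\omega_0,\dots,\omega_{\sigma-1}$ and the index sets $\Lambda_0,\dots,\Lambda_{\sigma-1}$ be those defined in the context. Let $m\in\{0,1,\dots,\sigma-1\}$ and let $\zeta_0\in\mathbb{C}$ be a zero of $\omega_m$ such that $\zeta_0\notin\{z_{\nu+1},\dots,z_\lambda\}$. Then: 1. If $|\zeta_0|<|z_{\nu+1}|$, then the whole sequence converges at $\zeta_0$ to the value of $r$: $$\lim_{n\to\infty}\pi^r_{n,\lambda-1}(\zeta_0)=r(\zeta_0).$$ 2. If $|\zeta_0|\ge|z_{\nu+1}|$, then $\lim_{n\to\infty}\pi^r_{n,\lambda-1}(\zeta_0)$ does not exist (as a finite complex number). If moreover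 $|\zeta_0|>|z_{\nu+1}|$, then $$\lim_{n\to\infty,\ n\in\Lambda_m}\pi^r_{n,\lambda-1}(\zeta_0)=\infty.$$
   Context: Padé approximants: for a function $r$ analytic at $0$ and integers $n,\mu\ge 0$, the Padé approximant $\pi^r_{n,\mu}$ of type $(n,\mu)$ is the rational function $P/Q$, where $P,Q$ are polynomials with $\deg P\le n$, $\deg Q\le\mu$, $Q\not\equiv 0$, and $Q(z)r(z)-P(z)=O(z^{n+\mu+1})$ as $z\to 0$. Such a pair exists and the quotient $P/Q$ is unique. Its value at a point is taken in $\mathbb{C}\cup\{\infty\}$. Notation, for $r=N/D$ with $D$ monic with simple roots $z_1,\dots,z_\lambda$ and a fixed $\nu<\lambda$: - $A_j$ is the residue of $r$ at $z_j$, and $D_j(z)=\dfrac{D(z)}{z-z_j}$, for $1\le j\le\lambda$. - $C_j=\dfrac{1}{D_j(z_j)^2A_j}$, for $1\le j\le\lambda$. - $\Delta(z)=(z-z_1)\cdots(z-z_\nu)$ and $\Delta_j(z)=\dfrac{\Delta(z)}{z-z_j}$, for $1\le j\le\nu$. - $\omega_m(z)=\displaystyle\sum_{j=1}^{\nu}C_jz_j^m\Delta_j(z)$, for $m=0,1,\dots,\sigma-1$. - $\Lambda_m=\{n\in\mathbb{N} : n+\lambda\equiv m \pmod{\sigma}\}$, for $m=0,1,\dots,\sigma-1$. *)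

theory Defs
  imports
    "HOL-Complex_Analysis.Complex_Analysis"
    "HOL-Computational_Algebra.Computational_Algebra"
    "HOL-Computational_Algebra.Field_as_Ring"
    "HOL-Number_Theory.Cong"
begin

text \<open>Here \<open>None\<close> is the point at infinity.\<close>

abbreviation extended_plane :: "complex option topology"
  where "extended_plane \<equiv> Alexandroff_compactification euclidean"

text \<open>\<open>quot_of_fract\<close> yields numerator and denominator in lowest terms, so removable
  singularities of a representation \<open>P/Q\<close> play no role in the value.\<close>

definition rat_value :: "complex poly fract \<Rightarrow> complex \<Rightarrow> complex option"
  where "rat_value f z =
    (let (P, Q) = quot_of_fract f in
       if poly Q z = 0 then None else Some (poly P z / poly Q z))"

definition pade_pair ::
    "(complex \<Rightarrow> complex) \<Rightarrow> nat \<Rightarrow> nat \<Rightarrow> complex poly \<Rightarrow> complex poly \<Rightarrow> bool"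
  where "pade_pair r n \<mu> P Q \<longleftrightarrow>
    degree P \<le> n \<and> degree Q \<le> \<mu> \<and> Q \<noteq> 0 \<and>
    (\<lambda>z. poly Q z * r z - poly P z) \<in> O[at 0](\<lambda>z. z ^ (n + \<mu> + 1))"

definition pade :: "(complex \<Rightarrow> complex) \<Rightarrow> nat \<Rightarrow> nat \<Rightarrow> complex poly fract"
  where "pade r n \<mu> = (THE f. \<exists>P Q. pade_pair r n \<mu> P Q \<and> f = Fract P Q)"

lemma poly_eq_0_if_bigo:
  fixes p :: "complex poly"
  assumes "degree p \<le> k" and "poly p \<in> O[at 0](\<lambda>z. z ^ (k + 1))"
  shows "p = 0"
proof (rule ccontr)
  assume "p \<noteq> 0"
  define m where "m = order 0 p"
  obtain q where q: "p = [:- 0, 1:] ^ m * q" "\<not> [:- 0, 1:] dvd q"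
    using order_decomp[OF \<open>p \<noteq> 0\<close>, of 0] unfolding m_def by blast
  have "m \<le> k"
    using order_degree[OF \<open>p \<noteq> 0\<close>, of 0] assms(1) by (simp add: m_def)
  have q0: "poly q 0 \<noteq> 0"
    using q(2) by (simp add: poly_eq_0_iff_dvd)
  obtain c where c: "eventually (\<lambda>z. norm (poly p z) \<le> c * norm (z ^ (k + 1))) (at 0)"
    using assms(2) by (auto elim: landau_o.bigE)
  have ne: "eventually (\<lambda>z::complex. z \<noteq> 0) (at 0)"
    by (simp add: eventually_at_filter)
  have ev: "eventually (\<lambda>z. norm (poly q z) \<le> norm (of_real c * z ^ (k + 1 - m))) (at 0)"
    using c ne
  proof eventually_elim
    case (elim z)
    have "norm z ^ m * norm (poly q z) \<le> norm z ^ m * (c * norm z ^ (k + 1 - m))"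
      using elim(1) \<open>m \<le> k\<close>
      by (simp add: q(1) norm_mult norm_power flip: power_add power_Suc mult.assoc)
        (simp add: mult_ac flip: power_add power_Suc)
    hence "norm (poly q z) \<le> c * norm z ^ (k + 1 - m)"
      using elim(2) by simp
    also have "\<dots> \<le> norm (of_real c * z ^ (k + 1 - m))"
      by (simp add: norm_mult norm_power mult_right_mono)
    finally show ?case .
  qed
  have "((\<lambda>z::complex. of_real c * z ^ (k + 1 - m)) \<longlongrightarrow> of_real c * 0 ^ (k + 1 - m)) (at 0)"
    by (intro tendsto_intros)
  hence "((\<lambda>z::complex. of_real c * z ^ (k + 1 - m)) \<longlongrightarrow> 0) (at 0)"
    using \<open>m \<le> k\<close> by (simp add: power_0_left)
  hence "(poly q \<longlongrightarrow> 0) (at 0)"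
    by (rule Lim_transform_bound[OF ev])
  moreover have "(poly q \<longlongrightarrow> poly q 0) (at 0)"
    by (intro tendsto_intros)
  ultimately show False
    using q0 tendsto_unique by (metis trivial_limit_at)
qed

lemma pade_eqI:
  assumes r: "isCont r 0" and PQ: "pade_pair r n \<mu> P Q"
  shows "pade r n \<mu> = Fract P Q"
  unfolding pade_def
proof (rule the_equality)
  show "\<exists>P' Q'. pade_pair r n \<mu> P' Q' \<and> Fract P Q = Fract P' Q'"
    using PQ by blast
next
  fix f assume "\<exists>P' Q'. pade_pair r n \<mu> P' Q' \<and> f = Fract P' Q'"
  then obtain P' Q' where PQ': "pade_pair r n \<mu> P' Q'" and f: "f = Fract P' Q'"
    by blast
  let ?g = "\<lambda>z::complex. z ^ (n + \<mu> + 1)"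
  have bounded: "poly p \<in> O[at 0](\<lambda>_. 1)" for p :: "complex poly"
    by (intro bigoI_tendsto[where c = "poly p 0"]) (auto intro!: tendsto_eq_intros)
  have "(\<lambda>z. poly Q' z * (poly Q z * r z - poly P z)) \<in> O[at 0](\<lambda>z. 1 * ?g z)"
    by (rule landau_o.big.mult[OF bounded]) (use PQ in \<open>simp add: pade_pair_def\<close>)
  moreover have "(\<lambda>z. poly Q z * (poly Q' z * r z - poly P' z)) \<in> O[at 0](\<lambda>z. 1 * ?g z)"
    by (rule landau_o.big.mult[OF bounded]) (use PQ' in \<open>simp add: pade_pair_def\<close>)
  ultimately have "(\<lambda>z. poly Q z * (poly Q' z * r z - poly P' z) -
      poly Q' z * (poly Q z * r z - poly P z)) \<in> O[at 0](?g)"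
    by (auto intro: sum_in_bigo)
  moreover have "(\<lambda>z. poly Q z * (poly Q' z * r z - poly P' z) -
      poly Q' z * (poly Q z * r z - poly P z)) = poly (Q' * P - Q * P')"
    by (auto simp: algebra_simps)
  ultimately have "poly (Q' * P - Q * P') \<in> O[at 0](\<lambda>z. z ^ (n + \<mu> + 1))"
    by simp
  moreover have "degree (Q' * P - Q * P') \<le> n + \<mu>"
  proof (rule degree_diff_le)
    show "degree (Q' * P) \<le> n + \<mu>" "degree (Q * P') \<le> n + \<mu>"
      using PQ PQ' degree_mult_le[of Q' P] degree_mult_le[of Q P']
      by (auto simp: pade_pair_def)
  qed
  ultimately have "Q' * P - Q * P' = 0"
    by (intro poly_eq_0_if_bigo)
  thus "f = Fract P Q"
    using PQ PQ' by (simp add: f pade_pair_def eq_fract mult_ac)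
qed

text \<open>In the following, \<open>D div [:- a, 1:]\<close> is the exact quotient \<open>D(z)/(z - a)\<close>, as \<open>a\<close>
  is always a root of the dividend.\<close>

definition C_coeff :: "(complex \<Rightarrow> complex) \<Rightarrow> complex poly \<Rightarrow> complex \<Rightarrow> complex"
  where "C_coeff r D a = 1 / ((poly (D div [:- a, 1:]) a)\<^sup>2 * residue r a)"

definition Delta :: "(nat \<Rightarrow> complex) \<Rightarrow> nat \<Rightarrow> complex poly"
  where "Delta z \<nu> = (\<Prod>j = 1..\<nu>. [:- z j, 1:])"

definition omega ::
    "(complex \<Rightarrow> complex) \<Rightarrow> complex poly \<Rightarrow> (nat \<Rightarrow> complex) \<Rightarrow> nat \<Rightarrow> nat \<Rightarrow> complex poly"
  where "omega r D z \<nu> m =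
    (\<Sum>j = 1..\<nu>. smult (C_coeff r D (z j) * z j ^ m) (Delta z \<nu> div [:- z j, 1:]))"

definition Lambda :: "nat \<Rightarrow> nat \<Rightarrow> nat \<Rightarrow> nat set"
  where "Lambda l \<sigma> m = {n. [n + l = m] (mod \<sigma>)}"

end

theory Submission
  imports Defs
begin

text \<open>Let \<open>Q r - P = O(z^(n+l))\<close> be the defining condition of the approximant of type \<open>(n, l-1)\<close>
  of \<open>r = N/D\<close>. Multiplying by \<open>D\<close> gives a polynomial \<open>Q N - P D\<close> of degree at most
  \<open>n + l\<close> (once \<open>n \<ge> l - 2\<close>), so it is a multiple of \<open>z^(n+l)\<close>, and not zero, since
  \<open>D\<close> is coprime to \<open>N\<close> and \<open>Q \<noteq> 0\<close> has smaller degree than \<open>D\<close>; normalise it to be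
  \<open>z^k\<close> with \<open>k = n + l\<close>. At a root \<open>z\<^sub>j\<close> of \<open>D\<close> this reads \<open>Q(z\<^sub>j) = z\<^sub>j^k / N(z\<^sub>j)\<close>,
  and Lagrange interpolation yields \<open>Q = \<Sum>\<^sub>j C\<^sub>j z\<^sub>j^k D\<^sub>j\<close>, with \<open>j\<close> from \<open>1\<close> to \<open>l\<close>. This is
  the formula for \<open>\<omega>\<^sub>k\<close> with all roots in place of the dominant ones
  (\<open>pade_pair_omega\<close>). Away from the roots,
  \<open>P/Q = r - \<zeta>^k / (D(\<zeta>)\<^sup>2 s\<^sub>k)\<close> with the exponential sum \<open>s\<^sub>k = \<Sum>\<^sub>j c\<^sub>j z\<^sub>j^k\<close>,
  \<open>c\<^sub>j = C\<^sub>j / (\<zeta> - z\<^sub>j) \<noteq> 0\<close>, and everything is a question about the size of \<open>s\<^sub>k\<close>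
  against \<open>\<zeta>^k\<close>.

  Split \<open>s\<^sub>k = t\<^sub>k + u\<^sub>k\<close> into the \<open>\<nu>\<close> dominant roots and the others. Since the dominant
  roots share their \<open>\<sigma>\<close>-th power, \<open>t\<close> is periodic up to a factor of modulus \<open>\<rho>^\<sigma>\<close>; hence in
  each residue class of \<open>k\<close> modulo \<open>\<sigma>\<close> either \<open>t\<close> vanishes identically or \<open>|t\<^sub>k|\<close> is at
  least a multiple of \<open>\<rho>^k\<close> (\<open>quasi_periodic_lower_bound\<close>). The tail \<open>u\<^sub>k\<close> is asymptotic to
  \<open>c\<^sub>\<nu>\<^sub>+\<^sub>1 a^k\<close> with \<open>a = z\<^sub>\<nu>\<^sub>+\<^sub>1\<close> (\<open>exponential_sum_dominant_term\<close>). That \<open>\<zeta>\<close> is a zero of \<open>\<omega>\<^sub>m\<close> means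
  precisely that \<open>t\<close> vanishes on the class of \<open>m\<close>, so that there \<open>s\<^sub>k\<close> has only the size of
  \<open>a^k\<close>, whereas \<open>|s\<^sub>k|\<close> is at least a multiple of \<open>|a|^k\<close> for all large \<open>k\<close>.

  If \<open>|\<zeta>| < |a|\<close>, the error \<open>\<zeta>^k / s\<^sub>k\<close> tends to \<open>0\<close>. If \<open>|\<zeta>| > |a|\<close>, it tends to infinity along the class of
  \<open>m\<close>. If \<open>|\<zeta>| = |a|\<close>, it stays bounded away from \<open>0\<close> on that class; but some class has
  \<open>t \<noteq> 0\<close>, because an exponential sum in \<open>\<nu>\<close> distinct nodes that vanishes \<open>\<nu>\<close> times in
  succession has zero coefficients (\<open>exponential_sum_vanishing_imp_zero_coeff\<close>), and on it the
  error tends to \<open>0\<close> because \<open>|\<zeta>| < \<rho>\<close>. The two classes are incompatible with a finite limit.\<close>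

section \<open>Values and limits in the extended plane\<close>

lemma limitin_extended_plane_Some_iff:
  assumes ev: "eventually (\<lambda>x. f x = Some (g x)) F"
  shows "limitin extended_plane f (Some c) F \<longleftrightarrow> (g \<longlongrightarrow> c) F"
proof
  assume lim: "limitin extended_plane f (Some c) F"
  show "(g \<longlongrightarrow> c) F"
    unfolding tendsto_def
  proof (intro allI impI)
    fix S :: "complex set" assume "open S" "c \<in> S"
    hence "eventually (\<lambda>x. f x \<in> Some ` S) F"
      by (intro limitinD[OF lim]) auto
    with ev show "eventually (\<lambda>x. g x \<in> S) F"
      by eventually_elim auto
  qed
next
  assume "(g \<longlongrightarrow> c) F"
  hence "limitin extended_plane (Some \<circ> g) (Some c) F"
    by (auto intro: continuous_map_limit[OF continuous_map_Some] )
  thus "limitin extended_plane f (Some c) F"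
    by (rule limitin_transform_eventually[rotated]) (use ev in \<open>simp add: eq_commute\<close>)
qed

lemma limitin_extended_plane_None:
  assumes ev: "eventually (\<lambda>x. f x = Some (g x)) F" and g: "filterlim g at_infinity F"
  shows "limitin extended_plane f None F"
  unfolding limitin_def
proof (intro conjI allI impI)
  fix U assume "openin extended_plane U \<and> None \<in> U"
  then obtain K where K: "compact K" "U = insert None (Some ` (- K))"
    by (auto simp: openin_Alexandroff_compactification Compl_eq_Diff_UNIV)
  obtain B where B: "\<And>x. x \<in> K \<Longrightarrow> norm x \<le> B"
    using compact_imp_bounded[OF K(1)] by (auto simp: bounded_iff)
  have "eventually (\<lambda>x. norm (g x) > B) F"
    using filterlim_at_infinity_imp_norm_at_top[OF g] by (simp add: filterlim_at_top_dense)
  with ev show "eventually (\<lambda>x. f x \<in> U) F"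
  proof eventually_elim
    case (elim x)
    hence "g x \<notin> K" using B[of "g x"] by auto
    thus ?case using elim(1) K(2) by auto
  qed
qed auto

text \<open>Cancelling a common factor of \<open>P\<close> and \<open>Q\<close> cannot create a pole, so any representation
  whose denominator does not vanish computes the value.\<close>

lemma rat_value_Fract:
  assumes Q: "poly Q z \<noteq> 0"
  shows "rat_value (Fract P Q) z = Some (poly P z / poly Q z)"
proof -
  obtain P' Q' where q: "quot_of_fract (Fract P Q) = (P', Q')" by fastforce
  have Q'0: "Q' \<noteq> 0" using snd_quot_of_fract_nonzero[of "Fract P Q"] q by simp
  have "Fract P' Q' = Fract P Q" using Fract_quot_of_fract[of "Fract P Q"] q by simp
  moreover have "Q \<noteq> 0" using Q by auto
  ultimately have eq: "P' * Q = P * Q'" using Q'0 by (simp add: eq_fract)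
  have "coprime P' Q'"
    using coprime_quot_of_fract[of "Fract P Q"] q by simp
  have "poly Q' z \<noteq> 0"
  proof
    assume 0: "poly Q' z = 0"
    have "poly P' z * poly Q z = poly P z * poly Q' z"
      using arg_cong[OF eq, of "\<lambda>p. poly p z"] by simp
    hence "poly P' z = 0" using 0 Q by simp
    with 0 \<open>coprime P' Q'\<close> show False
      by (meson coprime_poly_0)
  qed
  moreover have "poly P' z * poly Q z = poly P z * poly Q' z"
    using arg_cong[OF eq, of "\<lambda>p. poly p z"] by simp
  ultimately show ?thesis using Q
    by (simp add: rat_value_def q field_simps)
qed

section \<open>The polynomials \<open>\<omega>\<^sub>k\<close> as interpolants\<close>

lemma Delta_div_linear:
  assumes "i \<in> {1..\<nu>}"
  shows "Delta z \<nu> div [:- z i, 1:] = (\<Prod>j\<in>{1..\<nu>} - {i}. [:- z j, 1:])"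
proof -
  have "Delta z \<nu> = [:- z i, 1:] * (\<Prod>j\<in>{1..\<nu>} - {i}. [:- z j, 1:])"
    unfolding Delta_def using assms by (intro prod.remove) auto
  thus ?thesis by (metis nonzero_mult_div_cancel_left pCons_eq_0_iff one_neq_zero)
qed

lemma poly_Delta_eq_0_iff: "poly (Delta z \<nu>) w = 0 \<longleftrightarrow> w \<in> z ` {1..\<nu>}"
  by (auto simp: Delta_def poly_prod)

lemma poly_Delta_div_linear_node_nonzero:
  assumes "inj_on z {1..\<nu>}" "i \<in> {1..\<nu>}"
  shows "poly (Delta z \<nu> div [:- z i, 1:]) (z i) \<noteq> 0"
  unfolding Delta_div_linear[OF assms(2)] poly_prod
  by (simp add: prod_zero_iff) (use assms(2) in \<open>auto dest: inj_onD[OF assms(1)]\<close>)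

lemma poly_omega_at_node:
  assumes "i \<in> {1..\<nu>}"
  shows "poly (omega r D z \<nu> k) (z i) =
    C_coeff r D (z i) * z i ^ k * poly (Delta z \<nu> div [:- z i, 1:]) (z i)"
proof -
  have "poly (omega r D z \<nu> k) (z i) =
    (\<Sum>j\<in>{1..\<nu>}. C_coeff r D (z j) * z j ^ k * poly (Delta z \<nu> div [:- z j, 1:]) (z i))"
    by (simp add: omega_def poly_sum)
  also have "\<dots> = (\<Sum>j\<in>{i}. C_coeff r D (z j) * z j ^ k * poly (Delta z \<nu> div [:- z j, 1:]) (z i))"
    by (rule sum.mono_neutral_right) (use assms in \<open>auto simp: Delta_div_linear poly_prod\<close>)
  finally show ?thesis by simp
qed

text \<open>Each summand of \<open>\<omega>\<^sub>k\<close> is \<open>\<Delta>\<close> divided by a linear factor, so after dividing by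
  \<open>\<Delta>(w)\<close> the dependence on \<open>k\<close> is that of an exponential sum in the nodes.\<close>

lemma poly_omega_off_nodes:
  assumes "w \<notin> z ` {1..\<nu>}"
  shows "poly (omega r D z \<nu> k) w =
    poly (Delta z \<nu>) w * (\<Sum>j = 1..\<nu>. C_coeff r D (z j) / (w - z j) * z j ^ k)"
proof -
  have "poly (Delta z \<nu> div [:- z j, 1:]) w = poly (Delta z \<nu>) w / (w - z j)"
    if j: "j \<in> {1..\<nu>}" for j
  proof -
    have "Delta z \<nu> = [:- z j, 1:] * (Delta z \<nu> div [:- z j, 1:])"
      unfolding Delta_div_linear[OF j] unfolding Delta_def using j by (intro prod.remove) auto
    from arg_cong[OF this, of "\<lambda>p. poly p w"]
    have "poly (Delta z \<nu>) w = (w - z j) * poly (Delta z \<nu> div [:- z j, 1:]) w"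
      by (simp add: algebra_simps)
    thus ?thesis using assms j by auto
  qed
  thus ?thesis
    by (simp add: omega_def poly_sum sum_distrib_left mult_ac)
qed

lemma degree_omega_le: "degree (omega r D z \<nu> k) \<le> \<nu> - 1"
  unfolding omega_def
proof (rule degree_sum_le)
  fix j assume j: "j \<in> {1..\<nu>}"
  have "degree (Delta z \<nu> div [:- z j, 1:]) \<le> (\<Sum>i\<in>{1..\<nu>} - {j}. degree [:- z i, 1:])"
    unfolding Delta_div_linear[OF j]
    by (rule order_trans[OF degree_prod_sum_le]) auto
  thus "degree (smult (C_coeff r D (z j) * z j ^ k) (Delta z \<nu> div [:- z j, 1:])) \<le> \<nu> - 1"
    using j by (auto intro: order_trans[OF degree_smult_le])
qed auto

lemma residue_rational:
  assumes root: "poly D a = 0" and simple: "poly (D div [:- a, 1:]) a \<noteq> 0"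
  shows "residue (\<lambda>w. poly N w / poly D w) a = poly N a / poly (D div [:- a, 1:]) a"
proof -
  let ?E = "D div [:- a, 1:]"
  have D: "D = [:- a, 1:] * ?E"
    using root by (metis dvd_mult_div_cancel poly_eq_0_iff_dvd)
  have eq: "(\<lambda>w. poly N w / poly D w) = (\<lambda>w. poly N w / poly ?E w / (w - a))"
  proof
    fix w
    have "poly D w = (w - a) * poly ?E w"
      using arg_cong[OF D, of "\<lambda>p. poly p w"] unfolding poly_mult by simp
    thus "poly N w / poly D w = poly N w / poly ?E w / (w - a)"
      by (simp add: mult.commute)
  qed
  show ?thesis
    unfolding eq
  proof (rule residue_simple[where s = "{w. poly ?E w \<noteq> 0}" and f = "\<lambda>w. poly N w / poly ?E w"])
    have "open (poly ?E -` (- {0}))"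
      by (intro open_vimage continuous_intros)
    thus "open {w. poly ?E w \<noteq> 0}" by (simp add: vimage_def)
    show "(\<lambda>w. poly N w / poly ?E w) holomorphic_on {w. poly ?E w \<noteq> 0}"
      by (intro holomorphic_intros) auto
    show "a \<in> {w. poly ?E w \<noteq> 0}" using simple by simp
  qed
qed

lemma C_coeff_rational:
  assumes "poly D a = 0" "poly (D div [:- a, 1:]) a \<noteq> 0"
  shows "C_coeff (\<lambda>w. poly N w / poly D w) D a = 1 / (poly (D div [:- a, 1:]) a * poly N a)"
  using assms by (simp add: C_coeff_def residue_rational power2_eq_square)

text \<open>The remainder modulo \<open>D\<close> vanishes at as many points as \<open>D\<close> has roots, which is more
  than its degree allows.\<close>

lemma dvd_if_vanishes_on_simple_roots:
  fixes D p :: "'a :: field poly"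
  assumes D: "D \<noteq> 0" "card {w. poly D w = 0} = degree D"
    and p: "\<And>w. poly D w = 0 \<Longrightarrow> poly p w = 0"
  shows "D dvd p"
proof (rule ccontr)
  assume nd: "\<not> D dvd p"
  have nz: "p mod D \<noteq> 0" using nd by (simp add: dvd_eq_mod_eq_0)
  have "poly (p mod D) w = 0" if "poly D w = 0" for w
  proof -
    have "poly p w = poly (p div D * D + p mod D) w" by simp
    also have "\<dots> = poly (p mod D) w" using that by (simp only: poly_add poly_mult) simp
    finally show ?thesis using p[OF that] by simp
  qed
  hence "card {w. poly D w = 0} \<le> card {w. poly (p mod D) w = 0}"
    using nz by (intro card_mono poly_roots_finite) auto
  also have "\<dots> \<le> degree (p mod D)" by (rule card_poly_roots_bound[OF nz])
  also have "\<dots> < degree D" using D nd by (intro degree_mod_less_degree)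
  finally show False using D by simp
qed

section \<open>The Pade approximant in closed form\<close>

text \<open>With all roots of \<open>D\<close> as nodes, the constants \<open>C\<^sub>j\<close> are such that \<open>\<omega>\<^sub>k\<close> takes
  the value \<open>z\<^sub>j^k / N(z\<^sub>j)\<close> at every root. Hence \<open>\<omega>\<^sub>k N - z^k\<close> is divisible by \<open>D\<close>, and the
  quotient is the numerator \<open>P\<close>. The bound on \<open>n\<close> makes \<open>z^k\<close> dominate the degree of \<open>\<omega>\<^sub>k N\<close>,
  which is at most \<open>2 l - 2\<close>.\<close>

lemma pade_pair_omega:
  fixes N D :: "complex poly" and z :: "nat \<Rightarrow> complex"
  defines "r \<equiv> \<lambda>w. poly N w / poly D w"
  assumes D: "D = Delta z l" and inj: "inj_on z {1..l}" and deg: "degree D = l" and l: "0 < l"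
    and N: "degree N < l" "\<And>j. j \<in> {1..l} \<Longrightarrow> poly N (z j) \<noteq> 0"
    and D0: "poly D 0 \<noteq> 0" and n: "l \<le> n + 2"
  obtains P where "pade_pair r n (l - 1) P (omega r D z l (n + l))"
    and "P * D = omega r D z l (n + l) * N - monom 1 (n + l)"
proof -
  define k where "k = n + l"
  define Q where "Q = omega r D z l k"
  have roots: "{w. poly D w = 0} = z ` {1..l}"
    by (simp add: D poly_Delta_eq_0_iff)
  have nz: "poly (D div [:- z i, 1:]) (z i) \<noteq> 0" if "i \<in> {1..l}" for i
    unfolding D by (rule poly_Delta_div_linear_node_nonzero[OF inj that])
  have D_root: "poly D (z i) = 0" if "i \<in> {1..l}" for i
    using roots that by auto
  have Q_node: "poly Q (z i) * poly N (z i) = z i ^ k" if i: "i \<in> {1..l}" for i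
  proof -
    have "poly Q (z i) = C_coeff r D (z i) * z i ^ k * poly (D div [:- z i, 1:]) (z i)"
      unfolding Q_def using poly_omega_at_node[OF i, of r D z k] by (simp add: D)
    thus ?thesis
      unfolding r_def C_coeff_rational[OF D_root[OF i] nz[OF i]]
      using nz[OF i] N(2)[OF i] by simp
  qed
  have "D \<noteq> 0" using D0 by auto
  have "D dvd Q * N - monom 1 k"
  proof (rule dvd_if_vanishes_on_simple_roots)
    show "card {w. poly D w = 0} = degree D"
      unfolding roots deg card_image[OF inj] by simp
    fix w assume "poly D w = 0"
    hence "w \<in> z ` {1..l}" using roots by blast
    then obtain i where "i \<in> {1..l}" "w = z i" by blast
    thus "poly (Q * N - monom 1 k) w = 0" using Q_node[of i] by (simp add: poly_monom)
  qed fact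
  then obtain P where P: "P * D = Q * N - monom 1 k" by (metis dvd_div_mult_self)
  have degQ: "degree Q \<le> l - 1" unfolding Q_def by (rule degree_omega_le)
  have "degree P \<le> n"
  proof (cases "P = 0")
    case False
    have "degree (Q * N) \<le> k"
      using degree_mult_le[of Q N] degQ N(1) n unfolding k_def by linarith
    hence "degree (P * D) \<le> k"
      unfolding P by (intro degree_diff_le) (auto simp: degree_monom_eq)
    thus ?thesis using False \<open>D \<noteq> 0\<close> by (simp add: degree_mult_eq deg k_def)
  qed auto
  moreover have "Q \<noteq> 0"
  proof
    assume "Q = 0"
    hence "z 1 ^ k = 0" using Q_node[of 1] l by auto
    hence "z 1 = 0" by simp
    thus False using D_root[of 1] D0 l by simp
  qed
  moreover have "(\<lambda>w. poly Q w * r w - poly P w) \<in> O[at 0](\<lambda>w. w ^ k)"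
  proof -
    have "(poly D \<longlongrightarrow> poly D 0) (at 0)" by (intro tendsto_intros)
    hence D_ev: "eventually (\<lambda>w. poly D w \<noteq> 0) (at 0)"
      using D0 by (rule tendsto_imp_eventually_ne)
    have eq: "eventually (\<lambda>w. poly Q w * r w - poly P w = 1 / poly D w * w ^ k) (at 0)"
      using D_ev
    proof eventually_elim
      case (elim w)
      have "poly P w * poly D w = poly Q w * poly N w - w ^ k"
        using arg_cong[OF P, of "\<lambda>p. poly p w"] by (simp add: poly_monom)
      thus ?case using elim by (simp add: r_def field_simps)
    qed
    have "(\<lambda>w. 1 / poly D w) \<in> O[at 0](\<lambda>_. 1)"
      by (intro bigoI_tendsto[where c = "1 / poly D 0"]) (auto intro!: tendsto_eq_intros simp: D0)
    hence "(\<lambda>w. 1 / poly D w * w ^ k) \<in> O[at 0](\<lambda>w. 1 * w ^ k)"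
      by (rule landau_o.big.mult) simp
    thus ?thesis using landau_o.big.in_cong[OF eq] by simp
  qed
  ultimately show ?thesis
    using degQ P l that[of P] unfolding pade_pair_def Q_def k_def by auto
qed

lemma rat_value_pade:
  fixes N D :: "complex poly" and z :: "nat \<Rightarrow> complex"
  defines "r \<equiv> \<lambda>w. poly N w / poly D w"
  assumes D: "D = Delta z l" and inj: "inj_on z {1..l}" and deg: "degree D = l" and l: "0 < l"
    and N: "degree N < l" "\<And>j. j \<in> {1..l} \<Longrightarrow> poly N (z j) \<noteq> 0"
    and D0: "poly D 0 \<noteq> 0" and n: "l \<le> n + 2"
    and w: "poly D w \<noteq> 0" and Qw: "poly (omega r D z l (n + l)) w \<noteq> 0"
  shows "rat_value (pade r n (l - 1)) w =
    Some (r w - w ^ (n + l) / (poly D w * poly (omega r D z l (n + l)) w))"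
proof -
  let ?Q = "omega r D z l (n + l)"
  obtain P where P: "pade_pair r n (l - 1) P ?Q" "P * D = ?Q * N - monom 1 (n + l)"
    using pade_pair_omega[OF D inj deg l N D0 n] unfolding r_def by blast
  have "isCont r 0" unfolding r_def using D0 by (intro continuous_intros)
  hence "rat_value (pade r n (l - 1)) w = Some (poly P w / poly ?Q w)"
    using pade_eqI[OF _ P(1)] rat_value_Fract[OF Qw] by simp
  moreover have "poly P w * poly D w = poly ?Q w * poly N w - w ^ (n + l)"
    using arg_cong[OF P(2), of "\<lambda>p. poly p w"] by (simp add: poly_monom)
  hence "poly P w / poly ?Q w = r w - w ^ (n + l) / (poly D w * poly ?Q w)"
    using w Qw by (simp add: r_def field_simps)
  ultimately show ?thesis by simp
qed

section \<open>Growth of exponential sums\<close>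

text \<open>Invertibility of the Vandermonde matrix, in dual form: by linearity
  \<open>\<Sum>\<^sub>j c\<^sub>j p(z\<^sub>j) = 0\<close> for all polynomials \<open>p\<close> of degree below \<open>card J\<close>, and the Lagrange
  polynomial that vanishes at every node but \<open>z\<^sub>i\<close> isolates \<open>c\<^sub>i\<close>.\<close>

lemma exponential_sum_vanishing_imp_zero_coeff:
  fixes z c :: "'i \<Rightarrow> 'a :: field"
  assumes J: "finite J" "inj_on z J" "i \<in> J"
    and van: "\<And>k. k < card J \<Longrightarrow> (\<Sum>j\<in>J. c j * z j ^ k) = 0"
  shows "c i = 0"
proof -
  define p where "p = (\<Prod>j\<in>J - {i}. [:- z j, 1:])"
  have "degree p \<le> (\<Sum>j\<in>J - {i}. degree [:- z j, 1:])"
    unfolding p_def by (rule order_trans[OF degree_prod_sum_le]) (use J in auto)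
  also have "\<dots> < card J" using J card_gt_0_iff[of J] by fastforce
  finally have deg: "degree p < card J" .
  have "(\<Sum>j\<in>J. c j * poly p (z j)) = (\<Sum>j\<in>J. \<Sum>k\<le>degree p. coeff p k * (c j * z j ^ k))"
    by (simp add: poly_altdef sum_distrib_left mult_ac)
  also have "\<dots> = (\<Sum>k\<le>degree p. coeff p k * (\<Sum>j\<in>J. c j * z j ^ k))"
    by (subst sum.swap) (simp add: sum_distrib_left)
  also have "\<dots> = 0" using van deg by (intro sum.neutral) auto
  finally have "(\<Sum>j\<in>J. c j * poly p (z j)) = 0" .
  moreover have "(\<Sum>j\<in>J. c j * poly p (z j)) = (\<Sum>j\<in>{i}. c j * poly p (z j))"
    by (rule sum.mono_neutral_right) (use J in \<open>auto simp: p_def poly_prod\<close>)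
  moreover have "poly p (z i) \<noteq> 0"
    unfolding p_def poly_prod using J(1,3)
    by (simp add: prod_zero_iff) (use J(3) in \<open>auto dest: inj_onD[OF J(2)]\<close>)
  ultimately show ?thesis by simp
qed

lemma quasi_periodic_power:
  fixes t :: "nat \<Rightarrow> 'a :: comm_ring_1"
  assumes "\<And>k. t (k + \<sigma>) = w * t k"
  shows "t k = w ^ (k div \<sigma>) * t (k mod \<sigma>)"
proof -
  have "t (i + q * \<sigma>) = w ^ q * t i" for i q
  proof (induction q)
    case (Suc q)
    have "t (i + Suc q * \<sigma>) = t ((i + q * \<sigma>) + \<sigma>)" by (simp add: algebra_simps)
    thus ?case using Suc by (simp add: assms mult_ac)
  qed simp
  from this[of "k mod \<sigma>" "k div \<sigma>"] show ?thesis by simp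
qed

text \<open>The quotient \<open>|t k| / \<rho>^k\<close> is periodic, so it takes finitely many values and its
  nonzero values have a positive minimum.\<close>

lemma quasi_periodic_lower_bound:
  fixes t :: "nat \<Rightarrow> complex"
  assumes qp: "\<And>k. t (k + \<sigma>) = w * t k" and w: "norm w = \<rho> ^ \<sigma>" and \<rho>: "0 < \<rho>" and \<sigma>: "0 < \<sigma>"
  obtains b where "0 < b" "\<And>k. t k \<noteq> 0 \<Longrightarrow> b * \<rho> ^ k \<le> norm (t k)"
proof -
  \<comment> \<open>The element \<open>1\<close> only keeps the set nonempty when \<open>t\<close> vanishes identically.\<close>
  define S where "S = insert 1 ((\<lambda>i. norm (t i) / \<rho> ^ i) ` {i. i < \<sigma> \<and> t i \<noteq> 0})"
  have S: "finite S" "S \<noteq> {}" "\<And>x. x \<in> S \<Longrightarrow> 0 < x" using \<rho> by (auto simp: S_def)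
  show ?thesis
  proof (rule that[of "Min S"])
    show "0 < Min S" using S by simp
    fix k assume "t k \<noteq> 0"
    note eq = quasi_periodic_power[of t, OF qp, of k]
    let ?i = "k mod \<sigma>"
    have "norm (t ?i) / \<rho> ^ ?i \<in> S"
      using \<open>t k \<noteq> 0\<close> eq \<sigma> by (auto simp: S_def)
    hence "Min S \<le> norm (t ?i) / \<rho> ^ ?i" using S by simp
    hence "Min S * \<rho> ^ ?i \<le> norm (t ?i)" using \<rho> by (simp add: pos_le_divide_eq)
    hence "(\<rho> ^ \<sigma>) ^ (k div \<sigma>) * (Min S * \<rho> ^ ?i) \<le> (\<rho> ^ \<sigma>) ^ (k div \<sigma>) * norm (t ?i)"
      using \<rho> by (intro mult_left_mono) auto
    moreover have "(\<rho> ^ \<sigma>) ^ (k div \<sigma>) * \<rho> ^ ?i = \<rho> ^ k"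
      by (simp flip: power_mult power_add)
    moreover have "norm (t k) = (\<rho> ^ \<sigma>) ^ (k div \<sigma>) * norm (t ?i)"
      by (subst eq) (simp add: norm_mult norm_power w)
    ultimately show "Min S * \<rho> ^ k \<le> norm (t k)" by (simp add: mult_ac)
  qed
qed

lemma exponential_sum_dominant_term:
  fixes z c :: "'i \<Rightarrow> complex"
  assumes J: "finite J" "p \<in> J" and dom: "\<And>j. j \<in> J \<Longrightarrow> j \<noteq> p \<Longrightarrow> norm (z j) < norm (z p)"
    and zp: "z p \<noteq> 0"
  shows "(\<lambda>k. (\<Sum>j\<in>J. c j * z j ^ k) / z p ^ k) \<longlonglongrightarrow> c p"
proof -
  have "(\<lambda>k. \<Sum>j\<in>J. c j * (z j / z p) ^ k) \<longlonglongrightarrow> (\<Sum>j\<in>J. if j = p then c j else 0)"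
  proof (rule tendsto_sum)
    fix j assume j: "j \<in> J"
    show "(\<lambda>k. c j * (z j / z p) ^ k) \<longlonglongrightarrow> (if j = p then c j else 0)"
    proof (cases "j = p")
      case False
      hence "norm (z j / z p) < 1" using dom[OF j] zp by (simp add: norm_divide)
      hence "(\<lambda>k. c j * (z j / z p) ^ k) \<longlonglongrightarrow> c j * 0"
        by (intro tendsto_mult LIMSEQ_power_zero tendsto_const)
      thus ?thesis using False by simp
    qed (use zp in simp)
  qed
  moreover have "(\<Sum>j\<in>J. if j = p then c j else 0) = c p" using J by simp
  ultimately show ?thesis by (simp add: sum_divide_distrib power_divide)
qed

lemma eventually_scaled_power_le:
  fixes a b A B :: real
  assumes "0 \<le> a" "a < b" "0 < B"
  shows "eventually (\<lambda>k. A * a ^ k \<le> B * b ^ k) sequentially"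
proof -
  have "(\<lambda>k. A * (a / b) ^ k) \<longlonglongrightarrow> A * 0"
    using assms by (intro tendsto_mult tendsto_const LIMSEQ_power_zero) auto
  hence "eventually (\<lambda>k. A * (a / b) ^ k < B) sequentially"
    using assms by (intro order_tendstoD(2)[of _ "A * 0"]) auto
  thus ?thesis
  proof eventually_elim
    case (elim k)
    thus ?case using assms by (simp add: power_divide field_simps)
  qed
qed

text \<open>Here \<open>t\<close> is the part of the sum that is either zero or of size \<open>\<rho>^k\<close>, and \<open>u\<close> is
  the tail of the smaller size \<open>|a|^k\<close>. Where \<open>t\<close> is nonzero the tail cannot cancel it; where
  \<open>t\<close> is zero the tail itself is the lower bound.\<close>

lemma quasi_periodic_plus_geometric_bounds:
  fixes t u :: "nat \<Rightarrow> complex"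
  assumes u: "(\<lambda>k. u k / a ^ k) \<longlonglongrightarrow> c" "c \<noteq> 0" and a: "a \<noteq> 0" "norm a < \<rho>"
    and b: "0 < b" "\<And>k. t k \<noteq> 0 \<Longrightarrow> b * \<rho> ^ k \<le> norm (t k)"
  obtains B where "0 < B"
    and "eventually (\<lambda>k. B * norm a ^ k \<le> norm (t k + u k)) sequentially"
    and "eventually (\<lambda>k. t k \<noteq> 0 \<longrightarrow> B * \<rho> ^ k \<le> norm (t k + u k)) sequentially"
proof -
  \<comment> \<open>Half of \<open>b\<close> pays for subtracting the tail from \<open>t\<close>; half of \<open>|c|\<close> is the slack in
    the asymptotics of \<open>u\<close>.\<close>
  define B where "B = min (b / 2) (norm c / 2)"
  have B: "0 < B" "B \<le> b / 2" "B \<le> norm c / 2" using b u(2) by (auto simp: B_def)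
  have lim: "(\<lambda>k. norm (u k / a ^ k)) \<longlonglongrightarrow> norm c" by (intro tendsto_norm u)
  have "eventually (\<lambda>k. norm c / 2 < norm (u k / a ^ k)) sequentially"
    by (rule order_tendstoD(1)[OF lim]) (use u in simp)
  hence lo: "eventually (\<lambda>k. B * norm a ^ k \<le> norm (u k)) sequentially"
  proof eventually_elim
    case (elim k)
    hence "norm c / 2 * norm a ^ k \<le> norm (u k)"
      using a by (simp add: norm_divide norm_power pos_less_divide_eq less_imp_le)
    moreover have "B * norm a ^ k \<le> norm c / 2 * norm a ^ k" using B by (intro mult_right_mono) auto
    ultimately show ?case by linarith
  qed
  have "eventually (\<lambda>k. norm (u k / a ^ k) < 2 * norm c) sequentially"
    by (rule order_tendstoD(2)[OF lim]) (use u in simp)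
  hence hi: "eventually (\<lambda>k. norm (u k) \<le> 2 * norm c * norm a ^ k) sequentially"
  proof eventually_elim
    case (elim k)
    thus ?case using a by (simp add: norm_divide norm_power pos_divide_less_eq less_imp_le)
  qed
  have "eventually (\<lambda>k. 2 * norm c * norm a ^ k \<le> b / 2 * \<rho> ^ k) sequentially"
    using a b by (intro eventually_scaled_power_le) auto
  with hi have big: "eventually (\<lambda>k. t k \<noteq> 0 \<longrightarrow> B * \<rho> ^ k \<le> norm (t k + u k)) sequentially"
  proof eventually_elim
    case (elim k)
    show ?case
    proof
      assume "t k \<noteq> 0"
      hence "b * \<rho> ^ k \<le> norm (t k)" by (rule b)
      moreover have "norm (t k) \<le> norm (t k + u k) + norm (u k)"
        using norm_triangle_ineq4[of "t k + u k" "u k"] by simp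
      moreover have "B * \<rho> ^ k \<le> b / 2 * \<rho> ^ k"
        using B a norm_ge_zero[of a] by (intro mult_right_mono zero_le_power) linarith+
      ultimately show "B * \<rho> ^ k \<le> norm (t k + u k)"
        using elim by (simp add: field_simps)
    qed
  qed
  have "eventually (\<lambda>k. B * norm a ^ k \<le> norm (t k + u k)) sequentially"
    using lo big
  proof eventually_elim
    case (elim k)
    show ?case
    proof (cases "t k = 0")
      case False
      have "norm a ^ k \<le> \<rho> ^ k" using a by (intro power_mono) auto
      hence "B * norm a ^ k \<le> B * \<rho> ^ k" using B by (intro mult_left_mono) auto
      thus ?thesis using elim False by simp
    qed (use elim in simp)
  qed
  with B big show ?thesis by (intro that)
qed

lemma power_over_faster_tendsto_0:
  fixes s :: "nat \<Rightarrow> complex"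
  assumes F: "F \<le> sequentially" and B: "0 < B" "norm x < A"
    and s: "eventually (\<lambda>k. B * A ^ k \<le> norm (s k)) F"
  shows "((\<lambda>k. x ^ k / (d * s k)) \<longlongrightarrow> 0) F"
proof (rule Lim_null_comparison)
  show "eventually (\<lambda>k. norm (x ^ k / (d * s k)) \<le> (norm x / A) ^ k / (norm d * B)) F"
    using s
  proof eventually_elim
    case (elim k)
    have A: "0 < A" using B norm_ge_zero[of x] by linarith
    have "norm (x ^ k / (d * s k)) = norm x ^ k / norm d / norm (s k)"
      by (simp add: norm_mult norm_divide norm_power)
    also have "\<dots> \<le> norm x ^ k / norm d / (B * A ^ k)"
    proof (rule divide_left_mono[OF elim])
      have pos: "0 < B * A ^ k" using A B by simp
      with elim have "0 < norm (s k)" by linarith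
      thus "0 < norm (s k) * (B * A ^ k)" using pos by (rule mult_pos_pos)
    qed simp
    finally show ?case by (simp add: power_divide mult_ac)
  qed
  have "(\<lambda>k. (norm x / A) ^ k / (norm d * B)) \<longlonglongrightarrow> 0 / (norm d * B)"
    unfolding divide_inverse[of _ "norm d * B"]
    by (intro tendsto_mult tendsto_const LIMSEQ_power_zero)
      (use B norm_ge_zero[of x] in \<open>simp add: divide_less_eq; linarith\<close>)
  thus "((\<lambda>k. (norm x / A) ^ k / (norm d * B)) \<longlongrightarrow> 0) F"
    using F by (auto intro: tendsto_mono)
qed

text \<open>One bound for two uses: the left side grows without bound when \<open>|x| > |a|\<close>, and it is
  a positive constant when \<open>|x| = |a|\<close>.\<close>

lemma norm_power_over_slower:
  fixes s :: "nat \<Rightarrow> complex"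
  assumes s: "((\<lambda>k. s k / a ^ k) \<longlongrightarrow> c) F" "c \<noteq> 0" and "a \<noteq> 0" "d \<noteq> 0"
  obtains K where "0 < K" "eventually (\<lambda>k. K * (norm x / norm a) ^ k \<le> norm (x ^ k / (d * s k))) F"
proof (rule that)
  let ?K = "1 / (norm d * (2 * norm c))"
  show "0 < ?K" using assms by simp
  have "((\<lambda>k. norm (s k / a ^ k)) \<longlongrightarrow> norm c) F" by (intro tendsto_norm s)
  from order_tendstoD(2)[OF this, of "2 * norm c"] order_tendstoD(1)[OF this, of 0]
  have "eventually (\<lambda>k. norm (s k / a ^ k) < 2 * norm c) F" "eventually (\<lambda>k. 0 < norm (s k / a ^ k)) F"
    using assms by auto
  thus "eventually (\<lambda>k. ?K * (norm x / norm a) ^ k \<le> norm (x ^ k / (d * s k))) F"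
  proof eventually_elim
    case (elim k)
    have "norm (x ^ k / (d * s k)) = norm (x / a) ^ k / norm d / norm (s k / a ^ k)"
      using assms by (simp add: norm_mult norm_divide norm_power power_divide)
    also have "\<dots> \<ge> norm (x / a) ^ k / norm d / (2 * norm c)"
      using elim assms by (intro divide_left_mono mult_pos_pos) auto
    finally show ?case by (simp add: norm_divide mult_ac)
  qed
qed

section \<open>Convergence and divergence at the zeros of \<open>\<omega>\<^sub>m\<close>\<close>

text \<open>Limits along \<open>\<Lambda>\<^sub>i\<close> are unique only because \<open>\<Lambda>\<^sub>i\<close> is infinite.\<close>

lemma Lambda_filter_nontrivial:
  assumes "0 < \<sigma>"
  shows "inf sequentially (principal (Lambda l \<sigma> i)) \<noteq> bot"
proof
  assume "inf sequentially (principal (Lambda l \<sigma> i)) = bot"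
  hence "eventually (\<lambda>n. False) (inf sequentially (principal (Lambda l \<sigma> i)))" by simp
  then obtain M where M: "\<And>n. M \<le> n \<Longrightarrow> n \<notin> Lambda l \<sigma> i"
    by (auto simp: eventually_inf_principal eventually_sequentially)
  \<comment> \<open>The summand \<open>l * (\<sigma> - 1)\<close> stands for \<open>- l\<close> modulo \<open>\<sigma>\<close>.\<close>
  define n where "n = i + l * (\<sigma> - 1) + M * \<sigma>"
  have "n + l = i + (l + M) * \<sigma>"
    using assms by (cases \<sigma>) (simp_all add: n_def algebra_simps)
  hence "n \<in> Lambda l \<sigma> i" by (simp add: Lambda_def cong_def)
  moreover have "M \<le> M * \<sigma>" using assms by (cases \<sigma>) auto
  hence "M \<le> n" unfolding n_def by linarith
  ultimately show False using M by blast
qed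

theorem theorem1:
  fixes N D :: "complex poly"
    and r :: "complex \<Rightarrow> complex"
    and z :: "nat \<Rightarrow> complex"
    and \<zeta>\<^sub>0 :: complex
    and R \<rho> :: real
    and l \<nu> \<sigma> m :: nat
  assumes r: "r = (\<lambda>w. poly N w / poly D w)"
    and strictly_proper: "degree N < degree D"
    and coprime: "coprime N D"
    and monic: "lead_coeff D = 1"
    and degree: "degree D = l"
    and D_0: "poly D 0 \<noteq> 0"
    and disk: "\<And>w. is_pole r w \<Longrightarrow> cmod w < R"
    and simple_roots: "rsquarefree D"
    and roots: "bij_betw z {1..l} {w. poly D w = 0}"
    and \<nu>: "1 < \<nu>" "\<nu> < l"
    and dominant: "\<And>j. j \<in> {1..\<nu>} \<Longrightarrow> cmod (z j) = \<rho>"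
    and second: "\<rho> > cmod (z (\<nu> + 1))"
    and third: "\<nu> + 2 \<le> l \<Longrightarrow> cmod (z (\<nu> + 1)) > cmod (z (\<nu> + 2))"
    and remaining: "\<And>j. \<nu> + 2 \<le> j \<Longrightarrow> j < l \<Longrightarrow> cmod (z j) \<ge> cmod (z (j + 1))"
    and \<sigma>: "\<sigma> \<ge> \<nu>"
    and polygon: "\<And>i j. i \<in> {1..\<nu>} \<Longrightarrow> j \<in> {1..\<nu>} \<Longrightarrow> z i ^ \<sigma> = z j ^ \<sigma>"
    and m: "m \<in> {0..<\<sigma>}"
    and zero: "poly (omega r D z \<nu> m) \<zeta>\<^sub>0 = 0"
    and not_root: "\<zeta>\<^sub>0 \<notin> z ` {\<nu> + 1..l}"
  shows "(cmod \<zeta>\<^sub>0 < cmod (z (\<nu> + 1)) \<longrightarrow>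
           limitin extended_plane (\<lambda>n. rat_value (pade r n (l - 1)) \<zeta>\<^sub>0)
             (Some (r \<zeta>\<^sub>0)) sequentially) \<and>
         (cmod \<zeta>\<^sub>0 \<ge> cmod (z (\<nu> + 1)) \<longrightarrow>
           \<not> (\<exists>c. limitin extended_plane (\<lambda>n. rat_value (pade r n (l - 1)) \<zeta>\<^sub>0)
                    (Some c) sequentially)) \<and>
         (cmod \<zeta>\<^sub>0 > cmod (z (\<nu> + 1)) \<longrightarrow>
           limitin extended_plane (\<lambda>n. rat_value (pade r n (l - 1)) \<zeta>\<^sub>0)
             None (inf sequentially (principal (Lambda l \<sigma> m))))"
proof -
  define a where "a = z (\<nu> + 1)"
  define c where "c j = C_coeff r D (z j) / (\<zeta>\<^sub>0 - z j)" for j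
  define t where "t k = (\<Sum>j = 1..\<nu>. c j * z j ^ k)" for k
  define u where "u k = (\<Sum>j = \<nu> + 1..l. c j * z j ^ k)" for k
  define s where "s k = t k + u k" for k
  define d where "d = (poly D \<zeta>\<^sub>0)\<^sup>2"
  define e where "e k = \<zeta>\<^sub>0 ^ k / (d * s k)" for k
  \<comment> \<open>\<open>G\<close> filters the index \<open>n\<close> of the approximant, \<open>H\<close> the exponent \<open>k = n + l\<close>.\<close>
  define G where "G i = inf sequentially (principal (Lambda l \<sigma> i))" for i
  define H where "H i = inf sequentially (principal {k. k mod \<sigma> = i mod \<sigma>})" for i
  let ?\<pi> = "\<lambda>n. rat_value (pade r n (l - 1)) \<zeta>\<^sub>0"

  have \<sigma>_pos: "0 < \<sigma>" and l_pos: "0 < l" using \<sigma> \<nu> by auto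
  have inj: "inj_on z {1..l}" and root_set: "{w. poly D w = 0} = z ` {1..l}"
    using roots by (auto simp: bij_betw_def)
  have D: "D = Delta z l"
    using complex_poly_decompose_rsquarefree[OF simple_roots] monic
      prod.reindex_bij_betw[OF roots, of "\<lambda>w. [:- w, 1:]"]
    by (simp add: Delta_def)
  have D_root: "poly D (z j) = 0" if "j \<in> {1..l}" for j using root_set that by auto
  have N_root: "poly N (z j) \<noteq> 0" if "j \<in> {1..l}" for j
    using coprime_poly_0[OF coprime, of "z j"] D_root[OF that] by auto
  have D_simple: "poly (D div [:- z j, 1:]) (z j) \<noteq> 0" if "j \<in> {1..l}" for j
    unfolding D by (rule poly_Delta_div_linear_node_nonzero[OF inj that])
  have C_nz: "C_coeff r D (z j) \<noteq> 0" if "j \<in> {1..l}" for j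
    unfolding r C_coeff_rational[OF D_root[OF that] D_simple[OF that]]
    using D_simple[OF that] N_root[OF that] by simp
  have z_nz: "z j \<noteq> 0" if "j \<in> {1..l}" for j using D_root[OF that] D_0 by auto
  have inj_\<nu>: "inj_on z {1..\<nu>}" using \<nu> by (intro inj_on_subset[OF inj]) auto

  \<comment> \<open>At a dominant root only one summand of \<open>\<omega>\<^sub>m\<close> survives, and it is nonzero.\<close>
  have "\<zeta>\<^sub>0 \<notin> z ` {1..\<nu>}"
  proof
    assume "\<zeta>\<^sub>0 \<in> z ` {1..\<nu>}"
    then obtain i where i: "i \<in> {1..\<nu>}" "\<zeta>\<^sub>0 = z i" by auto
    have "i \<in> {1..l}" using i \<nu> by auto
    thus False
      using zero poly_omega_at_node[OF i(1), of r D z m]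
        poly_Delta_div_linear_node_nonzero[OF inj_\<nu> i(1)] C_nz z_nz i(2) by simp
  qed
  note not_dominant = this
  have "{1..l} = {1..\<nu>} \<union> {\<nu> + 1..l}" using \<nu> by auto
  hence not_node: "\<zeta>\<^sub>0 \<notin> z ` {1..l}" using not_dominant not_root by (metis UnE image_Un)
  hence D_nz: "poly D \<zeta>\<^sub>0 \<noteq> 0" unfolding D poly_Delta_eq_0_iff .
  hence d_nz: "d \<noteq> 0" by (simp add: d_def)
  have c_nz: "c j \<noteq> 0" if "j \<in> {1..l}" for j
    using C_nz[OF that] not_node that by (auto simp: c_def)

  have Q_eq: "poly (omega r D z l k) \<zeta>\<^sub>0 = poly D \<zeta>\<^sub>0 * s k" for k
  proof -
    have "s k = (\<Sum>j\<in>{1..\<nu>} \<union> {\<nu> + 1..l}. c j * z j ^ k)"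
      unfolding s_def t_def u_def by (rule sum.union_disjoint[symmetric]) auto
    also have "{1..\<nu>} \<union> {\<nu> + 1..l} = {1..l}" using \<nu> by auto
    finally show ?thesis
      using poly_omega_off_nodes[OF not_node, of r D k] by (simp add: c_def flip: D)
  qed

  have \<rho>_pos: "0 < \<rho>" using second norm_ge_zero[of "z (\<nu> + 1)"] by linarith
  have t_qp: "t (k + \<sigma>) = z 1 ^ \<sigma> * t k" for k
  proof -
    have "t (k + \<sigma>) = (\<Sum>j = 1..\<nu>. z 1 ^ \<sigma> * (c j * z j ^ k))"
      unfolding t_def
    proof (rule sum.cong)
      fix j assume "j \<in> {1..\<nu>}"
      hence "z j ^ \<sigma> = z 1 ^ \<sigma>" using \<nu> by (intro polygon) auto
      thus "c j * z j ^ (k + \<sigma>) = z 1 ^ \<sigma> * (c j * z j ^ k)" by (simp add: power_add)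
    qed simp
    thus ?thesis by (simp add: t_def sum_distrib_left)
  qed
  have z1: "norm (z 1) = \<rho>" "z 1 \<noteq> 0" using dominant[of 1] \<nu> z_nz[of 1] by auto
  have t_mod: "t k = 0 \<longleftrightarrow> t (k mod \<sigma>) = 0" for k
    by (subst quasi_periodic_power[of t, OF t_qp]) (use z1 in simp)
  have t_class: "t k = 0 \<longleftrightarrow> t i = 0" if "k mod \<sigma> = i mod \<sigma>" for i k
    using t_mod[of k] t_mod[of i] that by metis
  have t_m: "t m = 0"
  proof -
    have "poly (Delta z \<nu>) \<zeta>\<^sub>0 \<noteq> 0" using not_dominant by (simp add: poly_Delta_eq_0_iff)
    thus ?thesis
      using zero poly_omega_off_nodes[OF not_dominant, of r D m] by (simp add: t_def c_def)
  qed
  \<comment> \<open>The dominant part cannot vanish on all residue classes.\<close>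
  obtain m' where t_m': "t m' \<noteq> 0"
    using exponential_sum_vanishing_imp_zero_coeff[of "{1..\<nu>}" z 1 c] inj_\<nu> \<nu> c_nz[of 1]
    unfolding t_def by auto

  have dom: "norm (z j) < norm a" if "j \<in> {\<nu> + 1..l}" "j \<noteq> \<nu> + 1" for j
  proof -
    have "\<nu> + 2 \<le> j" using that by auto
    moreover have "j \<le> l \<longrightarrow> norm (z j) < norm a"
      using \<open>\<nu> + 2 \<le> j\<close>
    proof (induction j rule: dec_induct)
      case base
      show ?case using third by (simp add: a_def)
    next
      case (step j)
      show ?case using step remaining[of j] by auto
    qed
    ultimately show ?thesis using that by auto
  qed
  have a: "a \<noteq> 0" "norm a < \<rho>" using z_nz[of "\<nu> + 1"] \<nu> second by (auto simp: a_def)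
  have u_lim: "(\<lambda>k. u k / a ^ k) \<longlonglongrightarrow> c (\<nu> + 1)"
    unfolding u_def a_def
    by (rule exponential_sum_dominant_term) (use \<nu> dom a in \<open>auto simp: a_def\<close>)
  have c_a: "c (\<nu> + 1) \<noteq> 0" using \<nu> by (intro c_nz) auto
  obtain b where b: "0 < b" "\<And>k. t k \<noteq> 0 \<Longrightarrow> b * \<rho> ^ k \<le> norm (t k)"
    using quasi_periodic_lower_bound[of t \<sigma> "z 1 ^ \<sigma>" \<rho>, OF t_qp] z1 \<rho>_pos \<sigma>_pos
    by (auto simp: norm_power)
  obtain B where B: "0 < B" "eventually (\<lambda>k. B * norm a ^ k \<le> norm (s k)) sequentially"
      "eventually (\<lambda>k. t k \<noteq> 0 \<longrightarrow> B * \<rho> ^ k \<le> norm (s k)) sequentially"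
    using quasi_periodic_plus_geometric_bounds[of u a "c (\<nu> + 1)" \<rho> b t] u_lim c_a a b
    unfolding s_def by blast

  have shift: "filterlim (\<lambda>n. n + l) sequentially sequentially"
    by (rule filterlim_add_const_nat_at_top)
  have shift_class: "filterlim (\<lambda>n. n + l) (H i) (G i)" for i
    unfolding H_def G_def filterlim_inf
    by (auto simp: filterlim_principal eventually_inf_principal Lambda_def cong_def
        intro: filterlim_mono[OF shift] always_eventually)
  have G_le: "G i \<le> sequentially" and H_le: "H i \<le> sequentially" for i
    by (auto simp: G_def H_def)
  have G_nontrivial: "G i \<noteq> bot" for i
    unfolding G_def by (rule Lambda_filter_nontrivial[OF \<sigma>_pos])

  have value_ev: "eventually (\<lambda>n. ?\<pi> n = Some (r \<zeta>\<^sub>0 - e (n + l))) sequentially"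
  proof -
    have "eventually (\<lambda>k. s k \<noteq> 0) sequentially"
      using B(2)
    proof eventually_elim
      case (elim k)
      moreover have "0 < B * norm a ^ k" using B a by simp
      ultimately show ?case by auto
    qed
    hence "eventually (\<lambda>n. s (n + l) \<noteq> 0) sequentially"
      using eventually_compose_filterlim[OF _ shift] by blast
    thus ?thesis
      using eventually_ge_at_top[of l]
    proof eventually_elim
      case (elim n)
      have Q_nz: "poly (omega r D z l (n + l)) \<zeta>\<^sub>0 \<noteq> 0" using Q_eq D_nz elim(1) by simp
      have deg_N: "degree N < l" and n: "l \<le> n + 2" using strictly_proper degree elim(2) by auto
      have "?\<pi> n = Some (r \<zeta>\<^sub>0 - \<zeta>\<^sub>0 ^ (n + l) / (poly D \<zeta>\<^sub>0 * poly (omega r D z l (n + l)) \<zeta>\<^sub>0))"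
        unfolding r
        by (rule rat_value_pade[OF D inj degree l_pos deg_N N_root D_0 n D_nz Q_nz[unfolded r]])
      thus ?case unfolding Q_eq e_def d_def power2_eq_square mult.assoc .
    qed
  qed
  note value_class = filter_leD[OF G_le value_ev]

  \<comment> \<open>On the class of \<open>m\<close> the dominant part of the denominator vanishes and only the tail remains.\<close>
  have "eventually (\<lambda>k. u k / a ^ k = s k / a ^ k) (H m)"
    unfolding H_def eventually_inf_principal
    using t_class[of _ m] t_m by (intro always_eventually) (simp add: s_def)
  hence "((\<lambda>k. s k / a ^ k) \<longlongrightarrow> c (\<nu> + 1)) (H m)"
    by (rule Lim_transform_eventually[rotated]) (rule tendsto_mono[OF H_le u_lim])
  from norm_power_over_slower[OF this c_a a(1) d_nz, of \<zeta>\<^sub>0]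
  obtain K where K: "0 < K"
      "eventually (\<lambda>k. K * (norm \<zeta>\<^sub>0 / norm a) ^ k \<le> norm (e k)) (H m)"
    unfolding e_def by blast

  have far: "filterlim (\<lambda>n. r \<zeta>\<^sub>0 - e (n + l)) at_infinity (G m)" if "norm a < norm \<zeta>\<^sub>0"
  proof -
    have "filterlim (\<lambda>k. K * (norm \<zeta>\<^sub>0 / norm a) ^ k) at_top sequentially"
      using filterlim_at_infinity_imp_norm_at_top[OF filterlim_realpow_sequentially_gt1[of "\<zeta>\<^sub>0 / a"]]
        that a K
      by (intro filterlim_tendsto_pos_mult_at_top[OF tendsto_const]) (auto simp: norm_power norm_divide)
    hence "filterlim (\<lambda>k. K * (norm \<zeta>\<^sub>0 / norm a) ^ k) at_top (H m)"
      by (rule filterlim_mono) (use H_le in auto)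
    hence "filterlim (\<lambda>k. norm (e k)) at_top (H m)"
      by (rule filterlim_at_top_mono) (rule K)
    hence "filterlim e at_infinity (H m)" by (rule filterlim_norm_at_top_imp_at_infinity)
    from filterlim_compose[OF this shift_class]
    have "filterlim (\<lambda>n. - e (n + l)) at_infinity (G m)"
      by (simp add: filterlim_at_infinity_conv_norm_at_top)
    from tendsto_add_filterlim_at_infinity[OF tendsto_const this, of "r \<zeta>\<^sub>0"]
    show ?thesis by simp
  qed

  have near: "limitin extended_plane ?\<pi> (Some (r \<zeta>\<^sub>0)) sequentially" if "norm \<zeta>\<^sub>0 < norm a"
  proof -
    have "e \<longlonglongrightarrow> 0"
      unfolding e_def by (rule power_over_faster_tendsto_0[OF order_refl B(1) that B(2)])
    from tendsto_diff[OF tendsto_const filterlim_compose[OF this shift], of "r \<zeta>\<^sub>0"]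
    show ?thesis unfolding limitin_extended_plane_Some_iff[OF value_ev] by simp
  qed

  have no_limit: False
    if ge: "norm a \<le> norm \<zeta>\<^sub>0" and lim: "limitin extended_plane ?\<pi> (Some L) sequentially" for L
  proof -
    have g: "(\<lambda>n. r \<zeta>\<^sub>0 - e (n + l)) \<longlonglongrightarrow> L"
      using lim unfolding limitin_extended_plane_Some_iff[OF value_ev] .
    note g_class = tendsto_mono[OF G_le g]
    show False
    proof (cases "norm a < norm \<zeta>\<^sub>0")
      case True
      from not_tendsto_and_filterlim_at_infinity[OF G_nontrivial g_class far[OF True]]
      show False .
    next
      case False
      hence eq: "norm \<zeta>\<^sub>0 = norm a" using ge by simp
      \<comment> \<open>Where the dominant part survives, the approximants converge to \<open>r \<zeta>\<^sub>0\<close>, which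
        pins down the only possible limit.\<close>
      have "eventually (\<lambda>k. B * \<rho> ^ k \<le> norm (s k)) (H m')"
        using filter_leD[OF order_refl B(3)] unfolding H_def eventually_inf_principal
        by (rule eventually_mono) (use t_class[of _ m'] t_m' in blast)
      hence "(e \<longlongrightarrow> 0) (H m')"
        unfolding e_def by (intro power_over_faster_tendsto_0[OF H_le B(1), of _ \<rho>]) (use eq a in auto)
      from tendsto_diff[OF tendsto_const filterlim_compose[OF this shift_class], of "r \<zeta>\<^sub>0"]
      have "L = r \<zeta>\<^sub>0"
        using tendsto_unique[OF G_nontrivial g_class] by simp
      from tendsto_diff[OF tendsto_const g_class[of m], of "r \<zeta>\<^sub>0"]
      have "((\<lambda>n. e (n + l)) \<longlongrightarrow> 0) (G m)" by (simp add: \<open>L = r \<zeta>\<^sub>0\<close>)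
      hence "eventually (\<lambda>n. norm (e (n + l)) < K) (G m)"
        using K by (simp add: tendsto_iff)
      moreover have "eventually (\<lambda>n. K \<le> norm (e (n + l))) (G m)"
        using eventually_compose_filterlim[OF K(2) shift_class] eq a by simp
      ultimately have "eventually (\<lambda>n. False) (G m)" by eventually_elim simp
      thus False using G_nontrivial[of m] by simp
    qed
  qed

  show ?thesis
    using near no_limit limitin_extended_plane_None[OF value_class[of m] far]
    unfolding a_def G_def by blast
qed

end
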